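(* There exist positive absolute constants $C_5, C_6$, a function $\epsilon\mapsto C^{(1)}_{(\epsilon)}>0$ defined on $(0,1]$ and a function $T\mapsto C^{(2)}_{(T)}>0$ defined on $(2,\infty)$, such that the following holds for all $n\in\mathbb{N}$. (1) If $\epsilon\in(0,1]$, then $$\sup_{1\le w\le 1+\epsilon}\|\Phi_n(e^{i\theta},w)\|_{L^\infty(\mathbb{T})}>C^{(1)}_{(\epsilon)}\,n^{C_5\epsilon}.$$ (2) If $T>2$, then $$\sup_{1\le w\le T}\|\Phi_n(e^{i\theta},w)\|_{L^\infty(\mathbb{T})}>C^{(2)}_{(T)}\,n^{\frac12-C_6T^{-1/4}}.$$ Here the suprema are over all weights $w$ on $[-\pi,\pi]$ satisfying the indicated two-sided bound.
   Context: A weight is a function $w\in L^1(-\pi,\pi)$ with $w\ge 0$ and $w\not\equiv 0$; the unit circle $\mathbb{T}$ is parametrized by $e^{i\theta}$, $\theta\in[-\pi,\pi)$. Bounds such as $1\le w\le T$ are understood for (almost) all $\theta\in[-\pi,\pi]$. For a weight $w$, $\Phi_n(z,w)$ is the $n$-th monic orthogonal polynomial on the unit circle: $\deg\Phi_n=n$, the coefficient of $z^n$ is $1$, and $\int_{-\pi}^{\pi}\Phi_n(e^{i\theta},w)\overline{\Phi_m(e^{i\theta},w)}\,w(\theta)\,d\theta=0$ for all $m<n$. "Absolute constant" means independent of all parameters ($n,\epsilon,T$). *)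

theory Defs
  imports
    "HOL-Analysis.Analysis"
    "HOL-Probability.Essential_Supremum"
    "HOL-Computational_Algebra.Polynomial"
begin

text \<open>Weights are honest functions representing elements of \<open>L\<^sup>1(-\<pi>,\<pi>)\<close>, so that all
  pointwise conditions on them are required almost everywhere only. The closed interval is used
  for the underlying measure; its endpoints form a null set.\<close>

abbreviation circle_lebesgue :: "real measure" where
  "circle_lebesgue \<equiv> lebesgue_on {-pi..pi}"

definition is_weight :: "(real \<Rightarrow> real) \<Rightarrow> bool" where
  "is_weight w \<longleftrightarrow>
     integrable circle_lebesgue w \<and>
     (AE \<theta> in circle_lebesgue. 0 \<le> w \<theta>) \<and>
     \<not> (AE \<theta> in circle_lebesgue. w \<theta> = 0)"

definition weight_inner :: "(real \<Rightarrow> real) \<Rightarrow> complex poly \<Rightarrow> complex poly \<Rightarrow> complex" where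
  "weight_inner w p q =
     (\<integral>\<theta>. poly p (cis \<theta>) * cnj (poly q (cis \<theta>)) * complex_of_real (w \<theta>) \<partial>circle_lebesgue)"

definition is_monic_opuc :: "(real \<Rightarrow> real) \<Rightarrow> (nat \<Rightarrow> complex poly) \<Rightarrow> bool" where
  "is_monic_opuc w \<Phi> \<longleftrightarrow>
     (\<forall>n. degree (\<Phi> n) = n \<and> coeff (\<Phi> n) n = 1 \<and> (\<forall>m<n. weight_inner w (\<Phi> n) (\<Phi> m) = 0))"

text \<open>For a weight the description below is proper, see \<open>ex1_monic_opuc\<close>.\<close>

definition monic_opuc :: "(real \<Rightarrow> real) \<Rightarrow> nat \<Rightarrow> complex poly" where
  "monic_opuc w = (THE \<Phi>. is_monic_opuc w \<Phi>)"

definition circle_sup_norm :: "complex poly \<Rightarrow> ereal" where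
  "circle_sup_norm p = esssup circle_lebesgue (\<lambda>\<theta>. ereal (cmod (poly p (cis \<theta>))))"

definition bounded_weights :: "real \<Rightarrow> real \<Rightarrow> (real \<Rightarrow> real) set" where
  "bounded_weights a b =
     {w. is_weight w \<and> (AE \<theta> in circle_lebesgue. a \<le> w \<theta> \<and> w \<theta> \<le> b)}"


lemma weight_inner_integrable:
  assumes "is_weight w"
  shows "integrable circle_lebesgue
           (\<lambda>\<theta>. poly p (cis \<theta>) * cnj (poly q (cis \<theta>)) * complex_of_real (w \<theta>))"
proof -
  let ?g = "\<lambda>\<theta>. poly p (cis \<theta>) * cnj (poly q (cis \<theta>))"
  have c: "continuous_on {-pi..pi} ?g"
    by (intro continuous_intros)
  then have "compact (?g ` {-pi..pi})"
    by (intro compact_continuous_image) auto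
  then have "bounded (?g ` {-pi..pi})" by (rule compact_imp_bounded)
  then obtain B where "\<forall>z\<in>?g ` {-pi..pi}. cmod z \<le> B" unfolding bounded_iff by (elim exE)
  then have B: "cmod (?g \<theta>) \<le> B" if "\<theta> \<in> {-pi..pi}" for \<theta>
    using imageI[OF that] by (rule bspec)
  have m: "?g \<in> borel_measurable circle_lebesgue"
    using c by (intro continuous_imp_measurable_on_sets_lebesgue) auto
  have i: "integrable circle_lebesgue w" using assms by (simp add: is_weight_def)
  have wm [measurable]: "w \<in> borel_measurable circle_lebesgue" using i by auto
  have iB: "integrable circle_lebesgue (\<lambda>\<theta>. B * w \<theta>)" using i by simp
  show ?thesis
  proof (rule Bochner_Integration.integrable_bound[OF iB])
    show "(\<lambda>\<theta>. ?g \<theta> * complex_of_real (w \<theta>)) \<in> borel_measurable circle_lebesgue"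
      using m wm by measurable
    show "AE \<theta> in circle_lebesgue. norm (?g \<theta> * complex_of_real (w \<theta>)) \<le> norm (B * w \<theta>)"
    proof (rule AE_I2)
      fix \<theta> assume "\<theta> \<in> space circle_lebesgue"
      then have "\<theta> \<in> {-pi..pi}" by simp
      from B[OF this] have "cmod (?g \<theta>) \<le> \<bar>B\<bar>" by linarith
      then have "cmod (?g \<theta>) * \<bar>w \<theta>\<bar> \<le> \<bar>B\<bar> * \<bar>w \<theta>\<bar>" by (rule mult_right_mono) simp
      then show "norm (?g \<theta> * complex_of_real (w \<theta>)) \<le> norm (B * w \<theta>)"
        unfolding norm_mult[of "?g \<theta>"] norm_of_real real_norm_def abs_mult .
    qed
  qed
qed

lemma weight_inner_add:
  assumes "is_weight w"
  shows "weight_inner w (p + q) r = weight_inner w p r + weight_inner w q r"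
  using Bochner_Integration.integral_add
      [OF weight_inner_integrable[OF assms, of p r] weight_inner_integrable[OF assms, of q r]]
  by (simp add: weight_inner_def algebra_simps)

lemma weight_inner_smult: "weight_inner w (smult c p) q = c * weight_inner w p q"
proof -
  have "weight_inner w (smult c p) q =
    (\<integral>\<theta>. c * (poly p (cis \<theta>) * cnj (poly q (cis \<theta>)) * complex_of_real (w \<theta>)) \<partial>circle_lebesgue)"
    by (simp add: weight_inner_def mult.assoc)
  also have "\<dots> = c * weight_inner w p q"
    unfolding weight_inner_def by (rule integral_mult_right_zero)
  finally show ?thesis .
qed



lemma weight_inner_cnj: "weight_inner w q p = cnj (weight_inner w p q)"
proof -
  have "cnj (weight_inner w p q) =
      (\<integral>\<theta>. cnj (poly p (cis \<theta>) * cnj (poly q (cis \<theta>)) * complex_of_real (w \<theta>)) \<partial>circle_lebesgue)"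
    unfolding weight_inner_def by (rule Bochner_Integration.integral_cnj[symmetric])
  also have "\<dots> = weight_inner w q p"
    unfolding weight_inner_def
    by (intro Bochner_Integration.integral_cong refl) (simp add: mult.commute)
  finally show ?thesis ..
qed

lemma weight_inner_diff:
  assumes "is_weight w"
  shows "weight_inner w (p - q) r = weight_inner w p r - weight_inner w q r"
  using weight_inner_add[OF assms, of "p - q" q r] by simp

lemma weight_inner_0: "weight_inner w 0 q = 0"
  by (simp add: weight_inner_def)

lemma weight_inner_sum:
  assumes "is_weight w"
  shows "weight_inner w (\<Sum>i\<in>A. f i) q = (\<Sum>i\<in>A. weight_inner w (f i) q)"
  by (induction A rule: infinite_finite_induct)
     (simp_all add: weight_inner_0 weight_inner_add[OF assms])

lemma weight_inner_self_nonzero: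
  assumes w: "is_weight w" and p: "p \<noteq> 0"
  shows "weight_inner w p p \<noteq> 0"
proof
  assume z: "weight_inner w p p = 0"
  let ?f = "\<lambda>\<theta>. (cmod (poly p (cis \<theta>)))\<^sup>2 * w \<theta>"
  have eq: "(\<lambda>\<theta>. poly p (cis \<theta>) * cnj (poly p (cis \<theta>)) * complex_of_real (w \<theta>)) =
      (\<lambda>\<theta>. complex_of_real (?f \<theta>))"
    by (simp add: complex_norm_square[symmetric] del: of_real_power)
  have int: "integrable circle_lebesgue ?f"
    using weight_inner_integrable[OF w, of p p] unfolding eq complex_of_real_integrable_eq .
  have "integral\<^sup>L circle_lebesgue ?f = 0"
    using z unfolding weight_inner_def eq integral_complex_of_real by simp
  moreover have "AE \<theta> in circle_lebesgue. 0 \<le> ?f \<theta>"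
    using w unfolding is_weight_def by (auto elim: eventually_mono)
  ultimately have f0: "AE \<theta> in circle_lebesgue. ?f \<theta> = 0"
    using integral_nonneg_eq_0_iff_AE[OF int] by simp
  let ?Z = "{\<theta>\<in>{-pi..pi}. poly p (cis \<theta>) = 0}"
  have fin: "finite ?Z"
  proof (rule finite_subset)
    show "?Z \<subseteq> insert (-pi) (Arg ` {z. poly p z = 0})"
    proof
      fix \<theta> assume t: "\<theta> \<in> ?Z"
      show "\<theta> \<in> insert (-pi) (Arg ` {z. poly p z = 0})"
      proof (cases "\<theta> = -pi")
        case False
        then have "Arg (cis \<theta>) = \<theta>" using t by (intro cis_Arg_unique) auto
        then show ?thesis using t by (metis (mono_tags, lifting) image_eqI insertCI mem_Collect_eq)
      qed simp
    qed
    show "finite (insert (-pi) (Arg ` {z. poly p z = 0}))"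
      using poly_roots_finite[OF p] by simp
  qed
  have "?Z \<in> null_sets lebesgue"
    using fin negligible_finite negligible_iff_null_sets by blast
  then have "AE \<theta> in lebesgue. \<theta> \<notin> ?Z" by (rule AE_not_in)
  then have "AE \<theta> in circle_lebesgue. poly p (cis \<theta>) \<noteq> 0"
    by (subst AE_restrict_space_iff) (auto elim: eventually_mono)
  with f0 have "AE \<theta> in circle_lebesgue. w \<theta> = 0"
    by eventually_elim auto
  with w show False by (simp add: is_weight_def)
qed

lemma monic_family_spans:
  fixes \<Phi> :: "nat \<Rightarrow> complex poly"
  assumes "\<And>m. m < n \<Longrightarrow> degree (\<Phi> m) = m \<and> coeff (\<Phi> m) m = 1"
    and "p = 0 \<or> degree p < n"
  shows "\<exists>c. p = (\<Sum>m<n. smult (c m) (\<Phi> m))"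
  using assms
proof (induction n arbitrary: p)
  case (Suc n)
  let ?q = "p - smult (coeff p n) (\<Phi> n)"
  have d: "degree (\<Phi> n) = n" "coeff (\<Phi> n) n = 1" using Suc.prems(1)[of n] by auto
  have "degree p \<le> n" using Suc.prems(2) by auto
  then have dq: "degree ?q \<le> n"
    by (intro degree_diff_le) (use d in \<open>auto intro: order.trans[OF degree_smult_le]\<close>)
  have "coeff ?q n = 0" using d by simp
  then have "?q = 0 \<or> degree ?q < n"
    using dq by (metis leading_coeff_0_iff le_neq_implies_less)
  then obtain c where c: "?q = (\<Sum>m<n. smult (c m) (\<Phi> m))"
    using Suc.IH[of ?q] Suc.prems(1) by auto
  have "p = (\<Sum>m<Suc n. smult ((c(n := coeff p n)) m) (\<Phi> m))"
  proof -
    have "(\<Sum>m<Suc n. smult ((c(n := coeff p n)) m) (\<Phi> m)) =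
        (\<Sum>m<n. smult (c m) (\<Phi> m)) + smult (coeff p n) (\<Phi> n)"
      by (simp)
    also have "\<dots> = ?q + smult (coeff p n) (\<Phi> n)" by (simp only: c)
    also have "\<dots> = p" by simp
    finally show ?thesis ..
  qed
  then show ?case by blast
qed simp

lemma monic_opuc_step:
  assumes w: "is_weight w"
    and \<Phi>: "\<And>k. k < n \<Longrightarrow>
      degree (\<Phi> k) = k \<and> coeff (\<Phi> k) k = 1 \<and> (\<forall>m<k. weight_inner w (\<Phi> k) (\<Phi> m) = 0)"
  shows "\<exists>p. degree p = n \<and> coeff p n = 1 \<and> (\<forall>m<n. weight_inner w p (\<Phi> m) = 0)"
proof -
  define c where "c m = weight_inner w (monom 1 n) (\<Phi> m) / weight_inner w (\<Phi> m) (\<Phi> m)" for m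
  define s where "s = (\<Sum>m<n. smult (c m) (\<Phi> m))"
  have cs: "coeff s k = 0" if "k \<ge> n" for k
    unfolding s_def coeff_sum
    using \<Phi> that by (intro sum.neutral) (auto intro!: coeff_eq_0)
  have 1: "coeff (monom 1 n - s) n = 1" using cs by simp
  have 2: "degree (monom 1 n - s) = n"
  proof (rule antisym)
    show "degree (monom 1 n - s) \<le> n" using cs by (intro degree_le) auto
    show "n \<le> degree (monom 1 n - s)" using 1 by (intro le_degree) simp
  qed
  have 3: "weight_inner w (monom 1 n - s) (\<Phi> m) = 0" if m: "m < n" for m
  proof -
    have orth: "weight_inner w (\<Phi> k) (\<Phi> m) = 0" if "k < n" "k \<noteq> m" for k
    proof (cases "m < k")
      case False
      then have "weight_inner w (\<Phi> m) (\<Phi> k) = 0" using \<Phi>[OF m] that by auto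
      then show ?thesis by (subst weight_inner_cnj) simp
    qed (use \<Phi> that in auto)
    have nz: "weight_inner w (\<Phi> m) (\<Phi> m) \<noteq> 0"
      using \<Phi>[OF m] by (intro weight_inner_self_nonzero[OF w]) auto
    have "weight_inner w s (\<Phi> m) = (\<Sum>k<n. c k * weight_inner w (\<Phi> k) (\<Phi> m))"
      by (simp add: s_def weight_inner_sum[OF w] weight_inner_smult)
    also have "\<dots> = (\<Sum>k\<in>{m}. c k * weight_inner w (\<Phi> k) (\<Phi> m))"
      using m orth by (intro sum.mono_neutral_right) auto
    also have "\<dots> = weight_inner w (monom 1 n) (\<Phi> m)"
      using nz by (simp add: c_def)
    finally show ?thesis by (simp add: weight_inner_diff[OF w])
  qed
  show ?thesis using 1 2 3 by blast
qed

lemma ex1_monic_opuc: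
  assumes w: "is_weight w"
  shows "\<exists>!\<Phi>. is_monic_opuc w \<Phi>"
proof (rule ex_ex1I)
  have "\<exists>\<Phi>. \<forall>n. degree (\<Phi> n) = n \<and> coeff (\<Phi> n) n = 1 \<and>
      (\<forall>m<n. weight_inner w (\<Phi> n) (\<Phi> m) = 0)"
  proof (rule dependent_wf_choice[of less_than
        "\<lambda>\<Phi> n p. degree p = n \<and> coeff p n = 1 \<and> (\<forall>m<n. weight_inner w p (\<Phi> m) = 0)"])
    show "wf less_than" by simp
    show "\<exists>p. degree p = n \<and> coeff p n = 1 \<and> (\<forall>m<n. weight_inner w p (\<Phi> m) = 0)"
      if "\<And>k. (k, n) \<in> less_than \<Longrightarrow> degree (\<Phi> k) = k \<and> coeff (\<Phi> k) k = 1 \<and>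
        (\<forall>m<k. weight_inner w (\<Phi> k) (\<Phi> m) = 0)" for n \<Phi>
      using monic_opuc_step[OF w, of n \<Phi>] that by simp
  qed simp
  then show "\<exists>\<Phi>. is_monic_opuc w \<Phi>" by (simp add: is_monic_opuc_def)
next
  fix \<Phi> \<Psi> assume a: "is_monic_opuc w \<Phi>" and b: "is_monic_opuc w \<Psi>"
  have "\<Phi> n = \<Psi> n" for n
  proof (induction n rule: less_induct)
    case (less n)
    let ?d = "\<Phi> n - \<Psi> n"
    have "degree ?d \<le> n" "coeff ?d n = 0"
      using a b by (auto simp: is_monic_opuc_def intro!: degree_diff_le)
    then have "?d = 0 \<or> degree ?d < n"
      by (metis leading_coeff_0_iff le_neq_implies_less)
    then obtain c where c: "?d = (\<Sum>m<n. smult (c m) (\<Phi> m))"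
      using monic_family_spans[of n \<Phi> ?d] a by (auto simp: is_monic_opuc_def)
    have "weight_inner w ?d (\<Phi> m) = 0" if "m < n" for m
    proof -
      have "weight_inner w (\<Phi> n) (\<Phi> m) = 0" "weight_inner w (\<Psi> n) (\<Psi> m) = 0"
        using a b that unfolding is_monic_opuc_def by blast+
      then show ?thesis using less.IH[OF that] by (simp add: weight_inner_diff[OF w])
    qed
    then have orth: "weight_inner w (\<Phi> m) ?d = 0" if "m < n" for m
      using that by (subst weight_inner_cnj) simp
    have "weight_inner w ?d ?d = (\<Sum>m<n. c m * weight_inner w (\<Phi> m) ?d)"
    proof -
      have "weight_inner w ?d r = (\<Sum>m<n. c m * weight_inner w (\<Phi> m) r)" for r
        unfolding c by (simp add: weight_inner_sum[OF w] weight_inner_smult)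
      then show ?thesis .
    qed
    also have "\<dots> = 0" using orth by simp
    finally have "?d = 0" using weight_inner_self_nonzero[OF w] by blast
    then show ?case by simp
  qed
  then show "\<Phi> = \<Psi>" by blast
qed

end

theory Submission
  imports
    Defs
    "HOL-Complex_Analysis.Conformal_Mappings"
    "HOL-Real_Asymp.Real_Asymp"
begin

text \<open>
  Write \<open>p\<^sup>*\<close> for the reversal \<open>z\<^sup>n * cnj (p (1 / cnj z))\<close> of a polynomial \<open>p\<close>; on the unit circle
  it is \<open>z\<^sup>n * cnj (p z)\<close>. The growth of \<open>\<Phi>\<^sub>n\<close> comes from weights that oscillate like \<open>z\<^sup>n\<close>, with
  a phase that jumps at the point \<open>z = 1\<close>. They are obtained by prescribing the polynomial and
  reading off the weight. Let \<open>X\<close>, \<open>Y\<close> be polynomials of degree less than \<open>n\<close> with constant term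
  \<open>1\<close>, without zeros in the closed disc and with \<open>Re (X * cnj Y) > 0\<close> on the circle, and put

    \<open>D = X * Y + (X\<^sup>* * Y - X * Y\<^sup>*) / 2\<close>,  \<open>w = Re (X * cnj Y) / \<bar>D\<bar>\<^sup>2\<close>,
    \<open>\<Phi> = (X\<^sup>* + Y\<^sup>* + X - Y) / 2\<close>.

  On the circle \<open>\<Phi> * w\<close> is half the sum of \<open>z\<^sup>n * (X + Y) / D\<close> and \<open>cnj ((X - Y) / D)\<close>. Since \<open>D\<close>
  has no zeros in the disc and \<open>X - Y\<close> vanishes at \<open>0\<close>, multiplication by \<open>cnj (z ^ j)\<close> with
  \<open>j < n\<close> leaves two functions (up to conjugation) that are analytic and vanish at the origin, so
  their means are \<open>0\<close> and \<open>\<Phi>\<close> is the \<open>n\<close>-th monic orthogonal polynomial of \<open>w\<close>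
  (\<open>monic_opuc_weight\<close>).

  If \<open>v = X * cnj Y\<close> stays in the sector \<open>\<bar>Im v\<bar> \<le> s * \<bar>v\<bar>\<close>, then \<open>D = X * Y * (1 + h)\<close> with
  \<open>\<bar>h\<bar> = \<bar>Im v\<bar> / \<bar>v\<bar> \<le> s\<close>, and for \<open>\<bar>v\<bar>\<close> near \<open>1\<close> the oscillation of \<open>w\<close> is about
  \<open>((1 + s) / (1 - s))\<^sup>2\<close> (\<open>exists_bounded_weight\<close>). On the other hand \<open>Re (\<Phi> 1) = Re (X 1)\<close>.
  So \<open>X\<close> should be large at \<open>1\<close>, \<open>Y\<close> close to \<open>1 / X\<close>, and the argument of \<open>X\<close> small. The choice
  is \<open>X = (1 - l * z) powr - g\<close> and \<open>Y = (1 - l * z) powr g\<close> with \<open>0 < g < 1 / 2\<close>: the argument of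
  \<open>1 - l * z\<close> is at most \<open>\<pi> / 2\<close>, whence \<open>s = sin (\<pi> * g)\<close>. Truncating the binomial series and
  taking \<open>l = 1 - 3 * ln n / n\<close> costs errors that tend to \<open>0\<close>, and \<open>X 1\<close> is about
  \<open>(n / (3 * ln n)) powr g\<close>. Hence every exponent \<open>h < g\<close> is reached for all large \<open>n\<close> by weights
  with \<open>1 \<le> w \<le> T\<close>, as soon as \<open>((1 + sin (\<pi> * g)) / (1 - sin (\<pi> * g)))\<^sup>2 < T\<close>
  (\<open>eventually_large_opuc\<close>).

  For \<open>T = 1 + \<epsilon>\<close> this allows \<open>g\<close> proportional to \<open>\<epsilon>\<close>. For large \<open>T\<close> it requires
  \<open>1 - sin (\<pi> * g)\<close>, which is quadratic in \<open>1 / 2 - g\<close>, to exceed \<open>2 / sqrt T\<close>; this allows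
  \<open>1 / 2 - g\<close> of order \<open>T powr (- 1 / 4)\<close>. The finitely many remaining \<open>n\<close>, and all \<open>n\<close> when the
  exponent is not positive, are covered by \<open>\<Phi>\<^sub>n = z\<^sup>n\<close> for \<open>w = 1\<close>.
\<close>

section \<open>Weights, orthogonality and the sup norm\<close>

text \<open>For a continuous function the essential supremum dominates the value at every interior point of
  the interval, because a closed condition that holds almost everywhere holds everywhere.\<close>

lemma circle_sup_norm_ge:
  assumes "-pi < \<theta>" "\<theta> < pi"
  shows "ereal (cmod (poly p (cis \<theta>))) \<le> circle_sup_norm p"
proof -
  let ?f = "\<lambda>\<theta>. ereal (cmod (poly p (cis \<theta>)))"
  have "AE \<theta> in circle_lebesgue. ?f \<theta> \<le> circle_sup_norm p"
    unfolding circle_sup_norm_def by (rule esssup_AE)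
  then have "AE \<theta>\<in>{-pi..pi} in lebesgue. ?f \<theta> \<le> circle_sup_norm p"
    by (subst (asm) AE_restrict_space_iff) auto
  then have AE: "AE \<theta>\<in>{-pi<..<pi} in lebesgue. \<theta> \<in> {\<theta>. ?f \<theta> \<le> circle_sup_norm p}"
    by eventually_elim auto
  have closed: "closed {\<theta>. ?f \<theta> \<le> circle_sup_norm p}"
    by (intro closed_Collect_le[OF continuous_on_ereal continuous_on_const] continuous_intros)
  have "\<theta> \<in> {\<theta>. ?f \<theta> \<le> circle_sup_norm p}"
    using assms by (intro mem_closed_if_AE_lebesgue_open[OF _ closed AE]) auto
  then show ?thesis by simp
qed

lemma weight_inner_eq_0_of_monomials:
  assumes w: "is_weight w"
    and orth: "\<And>j. j < n \<Longrightarrow> weight_inner w q (monom 1 j) = 0"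
    and r: "r = 0 \<or> degree r < n"
  shows "weight_inner w r q = 0"
proof (cases "r = 0")
  case False
  then have d: "degree r < n" using r by auto
  have "r = (\<Sum>j\<le>degree r. smult (coeff r j) (monom 1 j))"
    by (simp add: poly_as_sum_of_monoms smult_monom)
  then have "weight_inner w r q = (\<Sum>j\<le>degree r. coeff r j * weight_inner w (monom 1 j) q)"
    by (metis (no_types, lifting) sum.cong weight_inner_sum[OF w] weight_inner_smult)
  also have "\<dots> = 0"
    using d orth by (intro sum.neutral ballI) (subst weight_inner_cnj, simp)
  finally show ?thesis .
qed (simp add: weight_inner_0)

text \<open>The difference of two monic candidates has degree less than \<open>n\<close>, so it is orthogonal to both of
  them and therefore to itself.\<close>

lemma monic_opuc_eqI:
  assumes w: "is_weight w" and q: "degree q = n" "coeff q n = 1"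
    and orth: "\<And>j. j < n \<Longrightarrow> weight_inner w q (monom 1 j) = 0"
  shows "monic_opuc w n = q"
proof -
  let ?\<Phi> = "monic_opuc w"
  have \<Phi>: "is_monic_opuc w ?\<Phi>"
    unfolding monic_opuc_def by (rule theI'[OF ex1_monic_opuc[OF w]])
  define d where "d = ?\<Phi> n - q"
  have "degree d \<le> n" "coeff d n = 0"
    using \<Phi> q by (auto simp: is_monic_opuc_def d_def intro!: degree_diff_le)
  then have d: "d = 0 \<or> degree d < n"
    by (metis leading_coeff_0_iff le_neq_implies_less)
  then obtain c where c: "d = (\<Sum>m<n. smult (c m) (?\<Phi> m))"
    using monic_family_spans[of n ?\<Phi> d] \<Phi> by (auto simp: is_monic_opuc_def)
  have "weight_inner w (?\<Phi> n) d = cnj (weight_inner w d (?\<Phi> n))"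
    by (rule weight_inner_cnj)
  also have "weight_inner w d (?\<Phi> n) = (\<Sum>m<n. c m * weight_inner w (?\<Phi> m) (?\<Phi> n))"
    by (subst c) (simp add: weight_inner_sum[OF w] weight_inner_smult)
  also have "\<dots> = 0"
    using \<Phi> by (intro sum.neutral ballI) (subst weight_inner_cnj, simp add: is_monic_opuc_def)
  finally have "weight_inner w (?\<Phi> n) d = 0" by simp
  moreover have "weight_inner w q d = 0"
    using weight_inner_eq_0_of_monomials[OF w orth d] by (subst weight_inner_cnj) simp
  ultimately have "weight_inner w d d = 0"
    by (subst (1) d_def) (simp add: weight_inner_diff[OF w])
  then have "d = 0" using weight_inner_self_nonzero[OF w] by blast
  then show ?thesis by (simp add: d_def)
qed

lemma is_weight_of_continuous_pos:
  assumes c: "continuous_on {-pi..pi} w" and pos: "\<And>\<theta>. 0 < w \<theta>"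
  shows "is_weight w"
proof -
  have "w \<theta> \<noteq> 0" for \<theta> using pos[of \<theta>] by simp
  moreover have "ae_filter circle_lebesgue \<noteq> bot"
    by (subst ae_filter_eq_bot_iff) (simp add: emeasure_restrict_space)
  ultimately have "\<not> (AE \<theta> in circle_lebesgue. w \<theta> = 0)"
    by (simp add: trivial_limit_def)
  then show ?thesis
    using continuous_imp_integrable_real[OF c] pos by (simp add: is_weight_def less_imp_le)
qed

text \<open>Up to the factor \<open>\<i>\<close> this integral is the contour integral of \<open>g\<close>, so it vanishes by Cauchy's
  theorem; it is used for means of functions that have a zero at the centre. The contour starts at angle
  \<open>-\<pi>\<close>, so that it is parametrized by the interval underlying the inner product.\<close>

lemma circle_integral_eq_0:
  assumes c: "continuous_on (cball 0 1) g" and h: "g holomorphic_on ball 0 1"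
  shows "(\<integral>\<theta>. cis \<theta> * g (cis \<theta>) \<partial>circle_lebesgue) = 0"
proof -
  let ?\<gamma> = "part_circlepath 0 1 (-pi) pi"
  have "(g has_contour_integral 0) ?\<gamma>"
  proof (rule Cauchy_theorem_convex[OF c, of "{}"])
    show "path_image ?\<gamma> \<subseteq> cball 0 1"
      using path_image_part_circlepath'[of 0 1 "-pi" pi] by auto
    show "g field_differentiable at x" if "x \<in> interior (cball 0 1) - {}" for x
      using that h by (metis Diff_empty holomorphic_on_imp_differentiable_at interior_cball open_ball)
    show "pathfinish ?\<gamma> = pathstart ?\<gamma>"
      by (simp add: exp_minus)
  qed auto
  then have "((\<lambda>t. g (cis t) * \<i> * cis t) has_integral 0) {-pi..pi}"
    by (subst (asm) has_contour_integral_part_circlepath_iff) auto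
  then have "((\<lambda>t. (- \<i>) * (g (cis t) * \<i> * cis t)) has_integral (- \<i>) * 0) {-pi..pi}"
    by (rule has_integral_mult_right)
  then have "((\<lambda>t. cis t * g (cis t)) has_integral 0) {-pi..pi}"
    by (simp add: algebra_simps)
  moreover have "integrable circle_lebesgue (\<lambda>\<theta>. cis \<theta> * g (cis \<theta>))"
    by (intro continuous_imp_integrable_real continuous_intros continuous_on_compose2[OF c]) auto
  ultimately show ?thesis
    by (simp add: lebesgue_integral_eq_integral integral_unique)
qed

section \<open>Orthogonal polynomials with a given sector pair\<close>

definition conj_reversal :: "nat \<Rightarrow> complex poly \<Rightarrow> complex poly" where
  "conj_reversal n p = (\<Sum>k\<le>n. monom (cnj (coeff p k)) (n - k))"

lemma coeff_conj_reversal: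
  "coeff (conj_reversal n p) m = (if m \<le> n then cnj (coeff p (n - m)) else 0)"
proof (cases "m \<le> n")
  case True
  have "coeff (conj_reversal n p) m = (\<Sum>k\<le>n. if k = n - m then cnj (coeff p k) else 0)"
    unfolding conj_reversal_def coeff_sum coeff_monom using True by (intro sum.cong) auto
  also have "\<dots> = cnj (coeff p (n - m))" by simp
  finally show ?thesis using True by simp
qed (auto simp: conj_reversal_def coeff_sum intro!: sum.neutral)

lemma poly_conj_reversal:
  assumes z: "cmod z = 1" and d: "degree p \<le> n"
  shows "poly (conj_reversal n p) z = z ^ n * cnj (poly p z)"
proof -
  have "cnj (coeff p k) * z ^ (n - k) = z ^ n * cnj (coeff p k * z ^ k)" if "k \<le> n" for k
  proof -
    have "z ^ n * cnj (z ^ k) = z ^ (n - k) * (z ^ k * cnj (z ^ k))"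
      using that by (simp add: power_add[symmetric])
    also have "z ^ k * cnj (z ^ k) = 1"
      by (subst complex_norm_square[symmetric]) (simp add: norm_power z)
    finally show ?thesis by (simp add: mult.left_commute)
  qed
  then have "poly (conj_reversal n p) z = (\<Sum>k\<le>n. z ^ n * cnj (coeff p k * z ^ k))"
    unfolding conj_reversal_def poly_sum poly_monom by (intro sum.cong) auto
  also have "\<dots> = z ^ n * cnj (\<Sum>k\<le>n. coeff p k * z ^ k)"
    by (simp add: sum_distrib_left)
  also have "(\<Sum>k\<le>n. coeff p k * z ^ k) = poly p z"
    by (subst (2) poly_as_sum_of_monoms'[OF d, symmetric]) (simp add: poly_sum poly_monom)
  finally show ?thesis .
qed

text \<open>The two hypotheses on \<open>X * cnj Y\<close> say that on the circle it lies in the sector of half-angle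
  \<open>arcsin s\<close> about the positive real axis.\<close>

locale sector_pair =
  fixes n :: nat and X Y :: "complex poly" and s :: real
  assumes degree_less: "degree X < n" "degree Y < n"
    and coeff_0: "coeff X 0 = 1" "coeff Y 0 = 1"
    and nonzero: "\<And>z. cmod z \<le> 1 \<Longrightarrow> poly X z \<noteq> 0" "\<And>z. cmod z \<le> 1 \<Longrightarrow> poly Y z \<noteq> 0"
    and Re_pos: "\<And>z. cmod z = 1 \<Longrightarrow> 0 < Re (poly X z * cnj (poly Y z))"
    and Im_le: "\<And>z. cmod z = 1 \<Longrightarrow>
      \<bar>Im (poly X z * cnj (poly Y z))\<bar> \<le> s * (cmod (poly X z) * cmod (poly Y z))"
    and s_less_1: "s < 1"
begin

text \<open>The candidate for \<open>\<Phi>\<^sub>n\<close>. Its leading coefficient comes from the reversals of \<open>X\<close> and \<open>Y\<close>, whose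
  \<open>n\<close>-th coefficients are the constant terms of \<open>X\<close> and \<open>Y\<close>.\<close>

definition opuc :: "complex poly" where
  "opuc = smult (1/2) (conj_reversal n X + conj_reversal n Y + (X - Y))"

definition denom :: "complex poly" where
  "denom = X * Y + smult (1/2) (conj_reversal n X * Y - X * conj_reversal n Y)"

definition weight :: "real \<Rightarrow> real" where
  "weight \<theta> = Re (poly X (cis \<theta>) * cnj (poly Y (cis \<theta>))) / (cmod (poly denom (cis \<theta>)))\<^sup>2"

text \<open>The relative deviation of \<open>denom\<close> from \<open>X * Y\<close>. On the circle its phase contains the factor
  \<open>z\<^sup>n\<close>, which makes the weight oscillate at frequency \<open>n\<close>.\<close>

definition tilt :: "complex \<Rightarrow> complex" where
  "tilt z = (poly (conj_reversal n X) z / poly X z - poly (conj_reversal n Y) z / poly Y z) / 2"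

lemma poly_denom: "cmod z \<le> 1 \<Longrightarrow> poly denom z = poly X z * poly Y z * (1 + tilt z)"
  using nonzero[of z] by (simp add: denom_def tilt_def field_simps)

lemma cmod_tilt_circle:
  assumes z: "cmod z = 1"
  shows "cmod (tilt z) =
    \<bar>Im (poly X z * cnj (poly Y z))\<bar> / (cmod (poly X z) * cmod (poly Y z))"
proof -
  let ?x = "poly X z" and ?y = "poly Y z"
  have nz: "?x \<noteq> 0" "?y \<noteq> 0" using nonzero z by auto
  have "cmod (tilt z) = cmod (z ^ n * ((cnj ?x * ?y - ?x * cnj ?y) / (2 * ?x * ?y)))"
    using nz degree_less by (simp add: tilt_def poly_conj_reversal[OF z] field_simps)
  also have "cnj ?x * ?y - ?x * cnj ?y = - (2 * \<i> * Im (?x * cnj ?y))"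
    by (simp add: complex_eq_iff)
  also have "cmod (z ^ n * (- (2 * \<i> * t) / (2 * ?x * ?y))) = \<bar>t\<bar> / (cmod ?x * cmod ?y)" for t :: real
    by (simp add: norm_mult norm_divide norm_power z)
  finally show ?thesis .
qed

text \<open>On the circle the sector condition is the bound; it extends to the disc by the maximum modulus
  principle, since \<open>X\<close> and \<open>Y\<close> have no zeros there.\<close>

lemma cmod_tilt_le:
  assumes "cmod z \<le> 1"
  shows "cmod (tilt z) \<le> s"
proof (rule maximum_modulus_frontier[of tilt "cball 0 1"])
  show "tilt holomorphic_on interior (cball 0 1)"
    unfolding tilt_def by (intro holomorphic_intros) (use nonzero in auto)
  show "continuous_on (closure (cball 0 1)) tilt"
    unfolding tilt_def by (intro continuous_intros) (use nonzero in auto)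
  fix z :: complex assume "z \<in> frontier (cball 0 1)"
  then have z: "cmod z = 1" by simp
  show "cmod (tilt z) \<le> s"
    unfolding cmod_tilt_circle[OF z] using Im_le[OF z] nonzero[of z] z
    by (subst pos_divide_le_eq) auto
qed (use assms in auto)

lemma denom_nonzero:
  assumes "cmod z \<le> 1"
  shows "poly denom z \<noteq> 0"
proof -
  have "1 + tilt z \<noteq> 0"
    using cmod_tilt_le[OF assms] s_less_1
    by (metis add.inverse_inverse add_eq_0_iff2 norm_minus_cancel norm_one not_le)
  then show ?thesis using nonzero[OF assms] by (simp add: poly_denom[OF assms])
qed

lemma degree_opuc: "degree opuc = n" and coeff_opuc: "coeff opuc n = 1"
proof -
  show *: "coeff opuc n = 1"
    using degree_less by (simp add: opuc_def coeff_conj_reversal coeff_0 coeff_eq_0)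
  show "degree opuc = n"
  proof (rule antisym)
    show "degree opuc \<le> n"
      using degree_less by (intro degree_le) (simp add: opuc_def coeff_conj_reversal coeff_eq_0)
    show "n \<le> degree opuc" using * by (intro le_degree) simp
  qed
qed

text \<open>The identity on which the construction rests. The first summand on the right is the
  boundary value of an analytic function with a zero of order \<open>n\<close> at the origin, the second is the
  conjugate of the boundary value of an analytic function that vanishes there, so the Fourier
  coefficients of the product with indices \<open>0, \<dots>, n - 1\<close> are zero.\<close>

lemma opuc_times_weight:
  fixes \<theta> :: real
  defines "z \<equiv> cis \<theta>"
  shows "poly opuc z * weight \<theta> =
    (z ^ n * (poly (X + Y) z / poly denom z) + cnj (poly (X - Y) z / poly denom z)) / 2"
proof -
  have z: "cmod z = 1" by (simp add: z_def)
  have denom_nz: "poly denom z \<noteq> 0" using denom_nonzero z by simp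
  define x y u where "x = poly X z" and "y = poly Y z" and "u = z ^ n"
  have u: "u * cnj u = 1"
    by (subst complex_norm_square[symmetric]) (simp add: u_def norm_power z)
  have q: "poly opuc z = (u * cnj x + u * cnj y + (x - y)) / 2"
    using degree_less by (simp add: opuc_def poly_conj_reversal[OF z] x_def y_def u_def)
  have e: "poly denom z = x * y + u * (cnj x * y - x * cnj y) / 2"
    using degree_less by (simp add: denom_def poly_conj_reversal[OF z] x_def y_def u_def field_simps)
  have r: "complex_of_real (Re (x * cnj y)) = (x * cnj y + cnj x * y) / 2"
    by (simp add: complex_eq_iff)
  have w: "complex_of_real (weight \<theta>) = (x * cnj y + cnj x * y) / 2 / (poly denom z * cnj (poly denom z))"
    unfolding weight_def complex_norm_square[symmetric] of_real_divide of_real_power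
      z_def[symmetric] x_def[symmetric] y_def[symmetric] r by (rule refl)
  have numerator: "(u * cnj x + u * cnj y + (x - y)) * (x * cnj y + cnj x * y) / 2 =
      u * (x + y) * cnj (poly denom z) + cnj (x - y) * poly denom z"
  proof -
    have "u * (x + y) * cnj (poly denom z) = u * (x + y) * cnj x * cnj y
        + (u * cnj u) * ((x + y) * (x * cnj y - cnj x * y) / 2)"
      by (simp add: e field_simps)
    also have "\<dots> = u * (x + y) * cnj x * cnj y + (x + y) * (x * cnj y - cnj x * y) / 2"
      unfolding u by simp
    finally have *: "u * (x + y) * cnj (poly denom z) = \<dots>" .
    show ?thesis
      unfolding * by (simp add: e field_simps)
  qed
  have "poly opuc z * weight \<theta> = ((u * cnj x + u * cnj y + (x - y)) * (x * cnj y + cnj x * y) / 2)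
      / (poly denom z * cnj (poly denom z)) / 2"
    unfolding q w by simp
  also have "\<dots> = (u * (x + y) * cnj (poly denom z) + cnj (x - y) * poly denom z) / (poly denom z * cnj (poly denom z)) / 2"
    by (simp only: numerator)
  also have "\<dots> = (u * ((x + y) / poly denom z) + cnj ((x - y) / poly denom z)) / 2"
    using denom_nz by (simp add: field_simps)
  finally show ?thesis by (simp add: x_def y_def u_def)
qed

lemma weight_pos: "0 < weight \<theta>"
  using Re_pos[of "cis \<theta>"] denom_nonzero[of "cis \<theta>"] by (simp add: weight_def)

lemma is_weight_scaled:
  assumes "0 < c"
  shows "is_weight (\<lambda>\<theta>. c * weight \<theta>)"
proof (rule is_weight_of_continuous_pos)
  show "continuous_on {-pi..pi} (\<lambda>\<theta>. c * weight \<theta>)"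
    unfolding weight_def by (intro continuous_intros) (auto simp: denom_nonzero)
  show "0 < c * weight \<theta>" for \<theta> using assms weight_pos by simp
qed

text \<open>Both terms of \<open>opuc_times_weight\<close>, multiplied by \<open>cnj (z ^ j)\<close>, contain a factor \<open>z\<close> (or its
  conjugate): the first because \<open>n - j > 0\<close>, the second because \<open>X - Y\<close> vanishes at the origin.\<close>

lemma weight_inner_opuc_monom:
  assumes "0 < c" "j < n"
  shows "weight_inner (\<lambda>\<theta>. c * weight \<theta>) opuc (monom 1 j) = 0"
proof -
  have "coeff (X - Y) 0 = 0" by (simp add: coeff_0)
  then obtain V where V: "X - Y = pCons 0 V"
    by (metis coeff_pCons_0 pCons_cases)
  define g where "g z = z ^ (n - Suc j) * (poly (X + Y) z / poly denom z)" for z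
  define h where "h z = z ^ j * (poly V z / poly denom z)" for z
  have cont: "continuous_on (cball 0 1) g" "continuous_on (cball 0 1) h"
    unfolding g_def h_def by (intro continuous_intros; use denom_nonzero in auto)+
  have hol: "g holomorphic_on ball 0 1" "h holomorphic_on ball 0 1"
    unfolding g_def h_def by (intro holomorphic_intros; use denom_nonzero in auto)+
  have int: "integrable circle_lebesgue (\<lambda>\<theta>. cis \<theta> * f (cis \<theta>))"
    if "continuous_on (cball 0 1) f" for f :: "complex \<Rightarrow> complex"
    by (intro continuous_imp_integrable_real continuous_intros continuous_on_compose2[OF that]) auto
  have "poly opuc (cis \<theta>) * cnj (poly (monom 1 j) (cis \<theta>)) * complex_of_real (c * weight \<theta>) =
      c / 2 * (cis \<theta> * g (cis \<theta>) + cnj (cis \<theta> * h (cis \<theta>)))" for \<theta>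
  proof -
    let ?z = "cis \<theta>"
    have u: "cnj (?z ^ j) * ?z ^ j = 1"
      by (simp add: mult.commute complex_norm_square[symmetric] norm_power del: complex_cnj_power)
    have "?z ^ n = ?z ^ j * (?z * ?z ^ (n - Suc j))"
      using assms(2) by (simp flip: power_add power_Suc)
    then have "cnj (?z ^ j) * ?z ^ n = (cnj (?z ^ j) * ?z ^ j) * (?z * ?z ^ (n - Suc j))"
      by (simp only: mult.assoc)
    then have 1: "cnj (?z ^ j) * ?z ^ n = ?z * ?z ^ (n - Suc j)"
      unfolding u by simp
    have "poly opuc ?z * cnj (poly (monom 1 j) ?z) * complex_of_real (c * weight \<theta>) =
        c * cnj (?z ^ j) * (poly opuc ?z * weight \<theta>)"
      by (simp add: poly_monom)
    also have "\<dots> = c / 2 * ((cnj (?z ^ j) * ?z ^ n) * (poly (X + Y) ?z / poly denom ?z)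
        + cnj (?z ^ j * (poly (X - Y) ?z / poly denom ?z)))"
      unfolding opuc_times_weight by (simp add: algebra_simps)
    also have "poly (X - Y) ?z = ?z * poly V ?z" by (simp add: V)
    finally show ?thesis unfolding 1 by (simp add: g_def h_def mult_ac)
  qed
  then have "weight_inner (\<lambda>\<theta>. c * weight \<theta>) opuc (monom 1 j) =
      (\<integral>\<theta>. c / 2 * (cis \<theta> * g (cis \<theta>) + cnj (cis \<theta> * h (cis \<theta>))) \<partial>circle_lebesgue)"
    unfolding weight_inner_def by (intro Bochner_Integration.integral_cong) simp_all
  also have "\<dots> = c / 2 * ((\<integral>\<theta>. cis \<theta> * g (cis \<theta>) \<partial>circle_lebesgue)
      + cnj (\<integral>\<theta>. cis \<theta> * h (cis \<theta>) \<partial>circle_lebesgue))"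
    using int[OF cont(1)] int[OF cont(2)]
    by (subst integral_mult_right_zero, subst Bochner_Integration.integral_add)
       (simp_all only: Bochner_Integration.integral_cnj integrable_cnj)
  also have "\<dots> = 0"
    by (simp add: circle_integral_eq_0[OF cont(1) hol(1)] circle_integral_eq_0[OF cont(2) hol(2)])
  finally show ?thesis .
qed

lemma monic_opuc_weight:
  assumes "0 < c"
  shows "monic_opuc (\<lambda>\<theta>. c * weight \<theta>) n = opuc"
  by (rule monic_opuc_eqI[OF is_weight_scaled[OF assms] degree_opuc coeff_opuc
        weight_inner_opuc_monom[OF assms]])

text \<open>At the point \<open>1\<close> reversal is plain conjugation, so \<open>Y\<close> contributes only to the imaginary part.\<close>

lemma Re_X_le_cmod_opuc: "Re (poly X 1) \<le> cmod (poly opuc 1)"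
proof -
  have "Re (poly opuc 1) = Re (poly X 1)"
    using degree_less by (simp add: opuc_def poly_conj_reversal)
  then show ?thesis by (metis complex_Re_le_cmod)
qed

lemma s_nonneg: "0 \<le> s"
proof -
  have "0 \<le> s * (cmod (poly X 1) * cmod (poly Y 1))" using Im_le[of 1] by simp
  moreover have "0 < cmod (poly X 1) * cmod (poly Y 1)" using nonzero[of 1] by simp
  ultimately show ?thesis by (simp add: zero_le_mult_iff)
qed

text \<open>With \<open>v = X * cnj Y\<close> and \<open>t = \<bar>Im v\<bar> / \<bar>v\<bar>\<close> the weight is \<open>sqrt (1 - t\<^sup>2) / (\<bar>1 + tilt\<bar>\<^sup>2 * \<bar>v\<bar>)\<close>
  with \<open>\<bar>tilt\<bar> = t \<le> s\<close>. Both bounds are worst at \<open>t = s\<close>. The numerators of the two bounds agree,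
  so they cancel in the quotient; estimating the upper numerator by \<open>1\<close> would spoil the exponent
  \<open>1 / 4\<close> of \<open>T\<close> in the final result.\<close>

lemma weight_bounds:
  fixes \<theta> :: real
  defines "z \<equiv> cis \<theta>"
  assumes ab: "0 < a" "a \<le> cmod (poly X z) * cmod (poly Y z)" "cmod (poly X z) * cmod (poly Y z) \<le> b"
  shows "sqrt (1 - s\<^sup>2) / ((1 + s)\<^sup>2 * b) \<le> weight \<theta>"
    and "weight \<theta> \<le> sqrt (1 - s\<^sup>2) / ((1 - s)\<^sup>2 * a)"
proof -
  have z: "cmod z = 1" by (simp add: z_def)
  define v where "v = poly X z * cnj (poly Y z)"
  define r where "r = cmod v"
  have r: "r = cmod (poly X z) * cmod (poly Y z)" by (simp add: r_def v_def norm_mult)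
  define t where "t = \<bar>Im v\<bar> / r"
  have r_pos: "0 < r" using ab r by linarith
  have t: "0 \<le> t" "t \<le> s"
    using Im_le[OF z] r_pos unfolding v_def[symmetric] r[symmetric] by (auto simp: t_def field_simps)
  have tilt: "cmod (tilt z) = t"
    using cmod_tilt_circle[OF z] by (simp add: t_def r v_def)
  have Re_v: "Re v = r * sqrt (1 - t\<^sup>2)"
  proof -
    have "r\<^sup>2 * (1 - t\<^sup>2) = (Re v)\<^sup>2"
      using r_pos by (simp add: t_def power_divide right_diff_distrib)
        (simp add: r_def cmod_power2)
    then have "sqrt (r\<^sup>2 * (1 - t\<^sup>2)) = Re v"
      using Re_pos[OF z] by (simp add: v_def)
    then show ?thesis using r_pos by (simp add: real_sqrt_mult)
  qed
  define m where "m = cmod (1 + tilt z)"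
  have m: "1 - t \<le> m" "m \<le> 1 + t"
    using norm_triangle_ineq[of 1 "tilt z"] norm_diff_ineq[of 1 "tilt z"] by (auto simp: m_def tilt)
  have "cmod (poly denom z) = r * m"
    using z by (simp add: poly_denom r m_def norm_mult)
  then have w: "weight \<theta> = sqrt (1 - t\<^sup>2) / (m\<^sup>2 * r)"
    using r_pos Re_v by (simp add: weight_def z_def[symmetric] v_def[symmetric] power2_eq_square field_simps)
  have ts: "t\<^sup>2 \<le> s\<^sup>2" "s\<^sup>2 < 1" "t\<^sup>2 < 1" "t < 1" using t s_less_1 by (auto simp: power_mono abs_square_less_1)
  show "sqrt (1 - s\<^sup>2) / ((1 + s)\<^sup>2 * b) \<le> weight \<theta>"
    unfolding w using ts t m ab s_less_1 r_pos
    by (intro frac_le mult_mono power_mono real_sqrt_le_mono) (auto simp: r)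
  \<comment> \<open>\<open>sqrt (1 - t\<^sup>2) / (1 - t)\<^sup>2\<close> increases with \<open>t\<close>; squaring and cancelling \<open>(1 - t) * (1 - s)\<close>
    reduces this to monotonicity of \<open>(1 + t) / (1 - t) ^ 3\<close>.\<close>
  have "(1 - t\<^sup>2) * (1 - s) ^ 4 \<le> (1 - s\<^sup>2) * (1 - t) ^ 4"
  proof -
    have "((1 + t) * (1 - s) ^ 3) * ((1 - t) * (1 - s)) \<le> ((1 + s) * (1 - t) ^ 3) * ((1 - t) * (1 - s))"
      using ts t s_less_1 by (intro mult_right_mono mult_mono power_mono) auto
    then show ?thesis by (simp add: power2_eq_square power4_eq_xxxx power3_eq_cube algebra_simps)
  qed
  then have "sqrt ((1 - t\<^sup>2) * (1 - s) ^ 4) \<le> sqrt ((1 - s\<^sup>2) * (1 - t) ^ 4)"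
    by (rule real_sqrt_le_mono)
  moreover have "sqrt (x ^ 4) = x\<^sup>2" for x :: real
    using real_sqrt_abs[of "x\<^sup>2"] by (simp flip: power_mult)
  ultimately have 1: "sqrt (1 - t\<^sup>2) * (1 - s)\<^sup>2 \<le> sqrt (1 - s\<^sup>2) * (1 - t)\<^sup>2"
    by (simp add: real_sqrt_mult)
  have "weight \<theta> \<le> sqrt (1 - t\<^sup>2) / ((1 - t)\<^sup>2 * a)"
    unfolding w using ts t m ab by (intro frac_le mult_mono power_mono) (auto simp: r)
  also have "\<dots> \<le> sqrt (1 - s\<^sup>2) / ((1 - s)\<^sup>2 * a)"
    using 1 ab s_less_1 ts by (simp add: field_simps)
  finally show "weight \<theta> \<le> sqrt (1 - s\<^sup>2) / ((1 - s)\<^sup>2 * a)" .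
qed

text \<open>Rescaling the weight leaves its orthogonal polynomials unchanged, so only the quotient of the
  two bounds of \<open>weight_bounds\<close> matters.\<close>

lemma exists_bounded_weight:
  assumes a: "0 < a"
    and ab: "\<And>z. cmod z = 1 \<Longrightarrow> a \<le> cmod (poly X z) * cmod (poly Y z)"
      "\<And>z. cmod z = 1 \<Longrightarrow> cmod (poly X z) * cmod (poly Y z) \<le> b"
    and T: "b / a * ((1 + s) / (1 - s))\<^sup>2 \<le> T"
  shows "\<exists>w\<in>bounded_weights 1 T. ereal (Re (poly X 1)) \<le> circle_sup_norm (monic_opuc w n)"
proof
  have "s\<^sup>2 < 1" using s_nonneg s_less_1 by (simp add: abs_square_less_1)
  then have root: "0 < sqrt (1 - s\<^sup>2)" by simp
  have b: "0 < b" using a ab(1)[of 1] ab(2)[of 1] by simp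
  define c where "c = (1 + s)\<^sup>2 * b / sqrt (1 - s\<^sup>2)"
  have c: "0 < c" using root b s_nonneg by (simp add: c_def)
  have bounds: "1 \<le> c * weight \<theta> \<and> c * weight \<theta> \<le> T" for \<theta>
  proof
    note w = weight_bounds[OF a ab(1) ab(2), of \<theta>]
    have "c * (sqrt (1 - s\<^sup>2) / ((1 + s)\<^sup>2 * b)) \<le> c * weight \<theta>"
      using w(1) c by (intro mult_left_mono) auto
    then show "1 \<le> c * weight \<theta>" using root b s_nonneg by (simp add: c_def)
    have "c * weight \<theta> \<le> c * (sqrt (1 - s\<^sup>2) / ((1 - s)\<^sup>2 * a))"
      using w(2) c by (intro mult_left_mono) auto
    also have "\<dots> = b / a * ((1 + s) / (1 - s))\<^sup>2"
      using root by (simp add: c_def power_divide mult.commute)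
    finally show "c * weight \<theta> \<le> T" using T by simp
  qed
  then show "(\<lambda>\<theta>. c * weight \<theta>) \<in> bounded_weights 1 T"
    using is_weight_scaled[OF c] by (simp add: bounded_weights_def)
  show "ereal (Re (poly X 1)) \<le> circle_sup_norm (monic_opuc (\<lambda>\<theta>. c * weight \<theta>) n)"
    using circle_sup_norm_ge[of 0 opuc] Re_X_le_cmod_opuc
    by (simp add: monic_opuc_weight[OF c]) (meson ereal_less_eq(3) order_trans)
qed

end

section \<open>Truncated binomial series\<close>

lemma cmod_gbinomial_le_1:
  fixes a :: complex
  assumes a: "cmod a \<le> 1"
  shows "cmod (a gchoose k) \<le> 1"
proof (induction k)
  case (Suc k)
  have "cmod (a - of_nat k) \<le> real (Suc k)"
    using norm_triangle_ineq4[of a "of_nat k"] a by simp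
  moreover have "a gchoose Suc k = (a gchoose k) * ((a - of_nat k) / of_nat (Suc k))"
    by (simp add: gbinomial_prod_rev)
  ultimately have "cmod (a gchoose Suc k) = cmod (a gchoose k) * (cmod (a - of_nat k) / real (Suc k))"
    by (simp only: norm_mult norm_divide norm_of_nat)
  also have "\<dots> \<le> 1 * 1"
    using Suc.IH \<open>cmod (a - of_nat k) \<le> real (Suc k)\<close> by (intro mult_mono) auto
  finally show ?case by simp
qed simp

text \<open>The Taylor section of degree less than \<open>n\<close> of \<open>(1 - l * z) powr a\<close>.\<close>

definition binomial_section :: "nat \<Rightarrow> real \<Rightarrow> real \<Rightarrow> complex poly" where
  "binomial_section n l a = (\<Sum>k<n. monom ((of_real a gchoose k) * (- of_real l) ^ k) k)"

lemma degree_binomial_section: "0 < n \<Longrightarrow> degree (binomial_section n l a) < n"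
  unfolding binomial_section_def
  by (intro degree_sum_less) (auto intro: le_less_trans[OF degree_monom_le])

lemma coeff_0_binomial_section: "0 < n \<Longrightarrow> coeff (binomial_section n l a) 0 = 1"
proof -
  assume "0 < n"
  have "coeff (binomial_section n l a) 0 = (\<Sum>k<n. if k = 0 then 1 else 0)"
    unfolding binomial_section_def coeff_sum coeff_monom by (intro sum.cong) auto
  then show ?thesis using \<open>0 < n\<close> by simp
qed

text \<open>As the binomial coefficients are bounded by \<open>1\<close>, the tail is dominated by a geometric series.\<close>

lemma binomial_section_error:
  assumes a: "\<bar>a\<bar> \<le> 1" and l: "0 \<le> l" "l < 1" and z: "cmod z \<le> 1"
  shows "cmod ((1 - of_real l * z) powr of_real a - poly (binomial_section n l a) z) \<le> l ^ n / (1 - l)"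
proof -
  let ?f = "\<lambda>k. (of_real a gchoose k) * (- (of_real l * z)) ^ k"
  have lz: "cmod (of_real l * z) \<le> l"
    using mult_left_mono[OF z l(1)] l by (simp add: norm_mult)
  then have "?f sums (1 + - (of_real l * z)) powr of_real a"
    using l by (intro gen_binomial_complex) simp
  then have "(\<lambda>k. ?f (k + n)) sums ((1 + - (of_real l * z)) powr of_real a - (\<Sum>k<n. ?f k))"
    by (rule sums_split_initial_segment)
  moreover have "(\<lambda>k. l ^ n * l ^ k) sums (l ^ n * (1 / (1 - l)))"
    using l by (intro sums_mult geometric_sums) simp
  ultimately have "cmod ((1 + - (of_real l * z)) powr of_real a - (\<Sum>k<n. ?f k)) \<le> l ^ n * (1 / (1 - l))"
  proof (rule norm_sums_le)
    fix k
    have "cmod (of_real a gchoose (k + n)) * cmod (of_real l * z) ^ (k + n) \<le> 1 * l ^ (k + n)"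
      using lz a l by (intro mult_mono power_mono cmod_gbinomial_le_1) auto
    then show "cmod (?f (k + n)) \<le> l ^ n * l ^ k"
      by (simp add: norm_mult norm_power power_add mult_ac)
  qed
  moreover have "(\<Sum>k<n. ?f k) = poly (binomial_section n l a) z"
    unfolding binomial_section_def poly_sum poly_monom
    by (intro sum.cong refl) (simp flip: power_mult_distrib)
  ultimately show ?thesis by simp
qed

text \<open>The error in multiplicative form: on the closed disc \<open>1 - l \<le> \<bar>1 - l * z\<bar> \<le> 2\<close>, so the power is
  at least \<open>(1 - l) / 2\<close> in modulus whatever the sign of the exponent.\<close>

lemma binomial_section_factor:
  assumes a: "\<bar>a\<bar> \<le> 1" and l: "0 \<le> l" "l < 1" and z: "cmod z \<le> 1"
  shows "\<exists>e. poly (binomial_section n l a) z = (1 - of_real l * z) powr of_real a * (1 + e) \<and>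
    cmod e \<le> 2 * l ^ n / (1 - l)\<^sup>2"
proof -
  let ?p = "1 - of_real l * z"
  let ?x = "?p powr of_real a"
  have lz: "cmod (of_real l * z) \<le> l"
    using mult_left_mono[OF z l(1)] l by (simp add: norm_mult)
  have p: "1 - l \<le> cmod ?p" "cmod ?p \<le> 2" 
    using norm_triangle_ineq2[of 1 "of_real l * z"] norm_triangle_ineq4[of 1 "of_real l * z"] lz l by auto
  have "(1 - l) / 2 \<le> cmod ?x"
  proof (cases "0 \<le> a")
    case True
    have "(1 - l) / 2 \<le> (1 - l) powr 1" using l by simp
    also have "\<dots> \<le> (1 - l) powr a" using a l by (intro powr_mono') auto
    also have "\<dots> \<le> cmod ?p powr a" using True p l by (intro powr_mono2) auto
    finally show ?thesis by (simp add: norm_powr_real_powr')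
  next
    case False
    have "(1 - l) / 2 \<le> 2 powr (-1)" using l by (simp add: powr_minus)
    also have "\<dots> \<le> 2 powr a" using a by (intro powr_mono) auto
    also have "\<dots> \<le> cmod ?p powr a" using False p l by (intro powr_mono2') auto
    finally show ?thesis by (simp add: norm_powr_real_powr')
  qed
  then have x: "(1 - l) / 2 \<le> cmod ?x" "?x \<noteq> 0" using l by auto
  define e where "e = (poly (binomial_section n l a) z - ?x) / ?x"
  have "cmod (poly (binomial_section n l a) z - ?x) \<le> l ^ n / (1 - l)"
    using binomial_section_error[OF a l z, of n] by (subst norm_minus_commute)
  then have "cmod e \<le> (l ^ n / (1 - l)) / ((1 - l) / 2)"
    unfolding e_def norm_divide using x l by (intro frac_le) auto
  then have "cmod e \<le> 2 * l ^ n / (1 - l)\<^sup>2" by (simp add: power2_eq_square mult.commute)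
  moreover have "poly (binomial_section n l a) z = ?x * (1 + e)"
    using x by (simp add: e_def field_simps)
  ultimately show ?thesis by blast
qed

text \<open>The moduli of the two powers cancel and their arguments add up to \<open>- 2 * g * Im (Ln p)\<close>, where
  \<open>\<bar>Im (Ln p)\<bar> < \<pi> / 2\<close> in the right half plane.\<close>

lemma powr_times_cnj_powr:
  assumes "0 < Re p"
  shows "\<exists>\<phi>. p powr (- of_real g) * cnj (p powr of_real g) = cis \<phi> \<and> \<bar>\<phi>\<bar> \<le> pi * \<bar>g\<bar>"
proof (intro exI conjI)
  have p: "p \<noteq> 0" using assms by auto
  have "p powr (- of_real g) * cnj (p powr of_real g) = exp (- (of_real g * (Ln p - cnj (Ln p))))"
    using p by (simp add: powr_def exp_cnj exp_add[symmetric] algebra_simps)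
  also have "\<dots> = cis (- 2 * g * Im (Ln p))"
    by (simp add: complex_diff_cnj cis_conv_exp algebra_simps)
  finally show "p powr (- of_real g) * cnj (p powr of_real g) = cis (- 2 * g * Im (Ln p))" .
  have "\<bar>Im (Ln p)\<bar> < pi / 2" using Re_Ln_pos_lt_imp[OF assms] .
  then have "2 * \<bar>g\<bar> * \<bar>Im (Ln p)\<bar> \<le> 2 * \<bar>g\<bar> * (pi / 2)" by (intro mult_left_mono) auto
  then show "\<bar>- 2 * g * Im (Ln p)\<bar> \<le> pi * \<bar>g\<bar>" by (simp add: abs_mult mult_ac)
qed

lemma binomial_section_product:
  fixes g l :: real and n :: nat
  defines "\<delta> \<equiv> 6 * l ^ n / (1 - l)\<^sup>2"
  assumes g: "0 < g" "g < 1 / 2" and l: "0 \<le> l" "l < 1" and \<delta>: "\<delta> < 1" and z: "cmod z \<le> 1"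
  shows "\<exists>\<phi>. \<bar>\<phi>\<bar> \<le> pi * g \<and>
    cmod (poly (binomial_section n l (- g)) z * cnj (poly (binomial_section n l g) z) - cis \<phi>) \<le> \<delta>"
proof -
  \<comment> \<open>Three error terms arise, each of size at most a third of \<open>\<delta>\<close>.\<close>
  have \<eta>: "2 * l ^ n / (1 - l)\<^sup>2 = \<delta> / 3" by (simp add: \<delta>_def)
  let ?p = "1 - of_real l * z"
  have "cmod (of_real l * z) \<le> l"
    using mult_left_mono[OF z l(1)] l by (simp add: norm_mult)
  then have "0 < Re ?p" using complex_Re_le_cmod[of "of_real l * z"] l by simp
  then obtain \<phi> where \<phi>: "?p powr (- of_real g) * cnj (?p powr of_real g) = cis \<phi>" "\<bar>\<phi>\<bar> \<le> pi * g"
    using powr_times_cnj_powr[of ?p g] g by auto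
  obtain e where e: "poly (binomial_section n l (- g)) z = ?p powr (- of_real g) * (1 + e)" "cmod e \<le> \<delta> / 3"
    using binomial_section_factor[of "- g" l z n] g l z by (auto simp: \<eta>)
  obtain f where f: "poly (binomial_section n l g) z = ?p powr (of_real g) * (1 + f)" "cmod f \<le> \<delta> / 3"
    using binomial_section_factor[of g l z n] g l z by (auto simp: \<eta>)
  have "poly (binomial_section n l (- g)) z * cnj (poly (binomial_section n l g) z) =
      (?p powr (- of_real g) * cnj (?p powr of_real g)) * ((1 + e) * (1 + cnj f))"
    by (simp add: e f mult_ac)
  also have "\<dots> = cis \<phi> + cis \<phi> * (e + cnj f + e * cnj f)"
    unfolding \<phi> by (simp add: algebra_simps)
  finally have "cmod (poly (binomial_section n l (- g)) z * cnj (poly (binomial_section n l g) z) - cis \<phi>)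
      = cmod (e + cnj f + e * cnj f)"
    by (simp add: norm_mult)
  also have "\<dots> \<le> cmod e + cmod f + cmod e * cmod f"
    by (metis complex_mod_cnj norm_mult norm_triangle_mono norm_triangle_ineq order_refl)
  also have "\<dots> \<le> \<delta> / 3 + \<delta> / 3 + \<delta> / 3 * 1"
    using order_trans[OF norm_ge_zero e(2)] e f \<delta> by (intro add_mono mult_mono) auto
  finally show ?thesis using \<phi> by auto
qed

text \<open>The product \<open>X * cnj Y\<close> is within \<open>\<delta>\<close> of a point \<open>cis \<phi>\<close> with \<open>\<bar>\<phi>\<bar> \<le> \<pi> * g < \<pi> / 2\<close>. So its imaginary
  part is at most \<open>sin (\<pi> * g) + \<delta>\<close>, its real part at least \<open>cos (\<pi> * g) - \<delta>\<close>, and its modulus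
  between \<open>1 - \<delta>\<close> and \<open>1 + \<delta>\<close>.\<close>

lemma sector_pair_binomial_section:
  fixes g l :: real and n :: nat
  defines "\<delta> \<equiv> 6 * l ^ n / (1 - l)\<^sup>2"
    and "X \<equiv> binomial_section n l (- g)" and "Y \<equiv> binomial_section n l g"
  assumes g: "0 < g" "g < 1 / 2" and l: "0 \<le> l" "l < 1" and n: "0 < n"
    and \<delta>: "\<delta> < 1" "\<delta> < cos (pi * g)" and s: "(sin (pi * g) + \<delta>) / (1 - \<delta>) < 1"
  shows "sector_pair n X Y ((sin (pi * g) + \<delta>) / (1 - \<delta>))"
    and "cmod z \<le> 1 \<Longrightarrow> cmod (poly X z) * cmod (poly Y z) \<in> {1 - \<delta>..1 + \<delta>}"
proof -
  have pg: "pi * g \<le> pi / 2" "0 \<le> pi * g" using g by auto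
  have prod: "\<exists>\<phi>. \<bar>\<phi>\<bar> \<le> pi * g \<and> cmod (poly X z * cnj (poly Y z) - cis \<phi>) \<le> \<delta>"
    if "cmod z \<le> 1" for z
    using binomial_section_product[OF g l, of n z] \<delta> that by (simp add: \<delta>_def X_def Y_def)
  show mem: "cmod (poly X z) * cmod (poly Y z) \<in> {1 - \<delta>..1 + \<delta>}" if z: "cmod z \<le> 1" for z
  proof -
    obtain \<phi> where "cmod (poly X z * cnj (poly Y z) - cis \<phi>) \<le> \<delta>" using prod[OF z] by auto
    moreover have "cmod (poly X z) * cmod (poly Y z) = cmod (poly X z * cnj (poly Y z))"
      by (simp add: norm_mult)
    ultimately show ?thesis
      using norm_triangle_ineq3[of "poly X z * cnj (poly Y z)" "cis \<phi>"] by auto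
  qed
  show "sector_pair n X Y ((sin (pi * g) + \<delta>) / (1 - \<delta>))"
  proof
    show "degree X < n" "degree Y < n" "coeff X 0 = 1" "coeff Y 0 = 1"
      using n by (simp_all add: X_def Y_def degree_binomial_section coeff_0_binomial_section)
    show "poly X z \<noteq> 0" "poly Y z \<noteq> 0" if "cmod z \<le> 1" for z
      using mem[OF that] \<delta> by auto
    show "(sin (pi * g) + \<delta>) / (1 - \<delta>) < 1" by fact
    fix z :: complex assume "cmod z = 1"
    then obtain \<phi> where \<phi>: "\<bar>\<phi>\<bar> \<le> pi * g" and d: "cmod (poly X z * cnj (poly Y z) - cis \<phi>) \<le> \<delta>"
      using prod[of z] by auto
    have "cos (pi * g) \<le> cos \<bar>\<phi>\<bar>"
      using \<phi> pg by (intro cos_monotone_0_pi_le) auto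
    then have "cos (pi * g) \<le> cos \<phi>" by simp
    moreover have "\<bar>Re (poly X z * cnj (poly Y z)) - cos \<phi>\<bar> \<le> \<delta>"
      using abs_Re_le_cmod[of "poly X z * cnj (poly Y z) - cis \<phi>"] d by (simp del: times_complex.sel)
    ultimately show "0 < Re (poly X z * cnj (poly Y z))" using \<delta> by linarith
    have "sin \<phi> \<le> sin (pi * g)" "sin (- \<phi>) \<le> sin (pi * g)"
      using \<phi> pg by (intro sin_monotone_2pi_le; linarith)+
    then have "\<bar>sin \<phi>\<bar> \<le> sin (pi * g)" by simp
    moreover have "\<bar>Im (poly X z * cnj (poly Y z)) - sin \<phi>\<bar> \<le> \<delta>"
      using abs_Im_le_cmod[of "poly X z * cnj (poly Y z) - cis \<phi>"] d by (simp del: times_complex.sel)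
    ultimately have "\<bar>Im (poly X z * cnj (poly Y z))\<bar> \<le> sin (pi * g) + \<delta>" by linarith
    also have "\<dots> = (sin (pi * g) + \<delta>) / (1 - \<delta>) * (1 - \<delta>)" using \<delta> by simp
    also have "\<dots> \<le> (sin (pi * g) + \<delta>) / (1 - \<delta>) * (cmod (poly X z) * cmod (poly Y z))"
    proof (rule mult_left_mono)
      have "0 \<le> \<delta>" using l by (simp add: \<delta>_def)
      moreover have "0 \<le> sin (pi * g)" using pg by (intro sin_ge_zero) auto
      ultimately show "0 \<le> (sin (pi * g) + \<delta>) / (1 - \<delta>)" using \<delta> by simp
    qed (use mem[of z] \<open>cmod z = 1\<close> in auto)
    finally show "\<bar>Im (poly X z * cnj (poly Y z))\<bar>
      \<le> (sin (pi * g) + \<delta>) / (1 - \<delta>) * (cmod (poly X z) * cmod (poly Y z))" .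
  qed
qed

section \<open>Growth of the orthogonal polynomials\<close>

lemma Re_binomial_section_ge:
  assumes g: "\<bar>g\<bar> \<le> 1" and l: "0 \<le> l" "l < 1"
  shows "(1 - l) powr g - l ^ n / (1 - l) \<le> Re (poly (binomial_section n l g) 1)"
proof -
  have "(1 - complex_of_real l) powr of_real g = of_real ((1 - l) powr g)"
    using powr_of_real[of "1 - l" g] l by simp
  then have "cmod (of_real ((1 - l) powr g) - poly (binomial_section n l g) 1) \<le> l ^ n / (1 - l)"
    using binomial_section_error[OF g l, of 1 n] by simp
  then have "\<bar>Re (of_real ((1 - l) powr g) - poly (binomial_section n l g) 1)\<bar> \<le> l ^ n / (1 - l)"
    by (rule order_trans[OF abs_Re_le_cmod])
  then show ?thesis by simp
qed

text \<open>The choice \<open>l = 1 - 3 * ln n / n\<close> balances two demands: \<open>l ^ n\<close> is at most \<open>n powr - 3\<close>, so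
  the error \<open>\<delta> n\<close> tends to \<open>0\<close>, while \<open>(1 - l) powr - g = (n / (3 * ln n)) powr g\<close> still beats
  every power \<open>n powr h\<close> with \<open>h < g\<close>. As \<open>\<delta> n\<close> tends to \<open>0\<close>, the bound on the oscillation of the
  weight tends to the left-hand side of the hypothesis on \<open>T\<close>.\<close>

lemma eventually_large_opuc:
  assumes g: "0 < g" "g < 1 / 2" and h: "h < g"
    and T: "((1 + sin (pi * g)) / (1 - sin (pi * g)))\<^sup>2 < T"
  shows "\<forall>\<^sub>F n in sequentially. \<exists>w\<in>bounded_weights 1 T.
    ereal (real n powr h) < circle_sup_norm (monic_opuc w n)"
proof -
  define \<sigma> where "\<sigma> = sin (pi * g)"
  define l where "l n = 1 - 3 * ln (real n) / real n" for n :: nat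
  define \<delta> where "\<delta> n = 6 * l n ^ n / (1 - l n)\<^sup>2" for n :: nat
  define s where "s n = (\<sigma> + \<delta> n) / (1 - \<delta> n)" for n
  have pg: "0 < pi * g" "pi * g < pi / 2" using g by simp_all
  then have cos: "0 < cos (pi * g)" by (intro cos_gt_zero)
  have "- (pi / 2) \<le> pi * g" using pg by linarith
  then have \<sigma>: "\<sigma> < 1"
    using sin_monotone_2pi[of "pi * g" "pi / 2"] pg by (simp add: \<sigma>_def)
  have \<delta>0: "\<delta> \<longlonglongrightarrow> 0" unfolding \<delta>_def l_def by real_asymp
  have s0: "s \<longlonglongrightarrow> (\<sigma> + 0) / (1 - 0)"
    unfolding s_def by (intro tendsto_intros \<delta>0) auto
  have "(\<lambda>n. (1 + \<delta> n) / (1 - \<delta> n) * ((1 + s n) / (1 - s n))\<^sup>2) \<longlonglongrightarrow>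
      (1 + 0) / (1 - 0) * ((1 + (\<sigma> + 0) / (1 - 0)) / (1 - (\<sigma> + 0) / (1 - 0)))\<^sup>2"
    using \<sigma> by (intro tendsto_intros \<delta>0 s0) auto
  then have T': "\<forall>\<^sub>F n in sequentially. (1 + \<delta> n) / (1 - \<delta> n) * ((1 + s n) / (1 - s n))\<^sup>2 < T"
    using T by (intro order_tendstoD) (auto simp: \<sigma>_def)
  have l: "\<forall>\<^sub>F n in sequentially. 0 \<le> l n" "\<forall>\<^sub>F n in sequentially. l n < 1"
    unfolding l_def by real_asymp+
  have growth: "\<forall>\<^sub>F n in sequentially. real n powr h < (3 * ln (real n) / real n) powr (- g) - 1"
    using h g by real_asymp
  have "\<forall>\<^sub>F n in sequentially. \<delta> n < 1" "\<forall>\<^sub>F n in sequentially. \<delta> n < cos (pi * g)"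
    "\<forall>\<^sub>F n in sequentially. s n < 1"
    using order_tendstoD(2)[OF \<delta>0] order_tendstoD(2)[OF s0, of 1] cos \<sigma> by auto
  then show ?thesis
    using T' l growth eventually_gt_at_top[of 0]
  proof eventually_elim
    case (elim n)
    let ?X = "binomial_section n (l n) (- g)" and ?Y = "binomial_section n (l n) g"
    interpret sector_pair n ?X ?Y "s n"
      unfolding s_def \<delta>_def \<sigma>_def
      by (rule sector_pair_binomial_section) (use elim g in \<open>auto simp: s_def \<delta>_def \<sigma>_def\<close>)
    have XY: "cmod (poly ?X z) * cmod (poly ?Y z) \<in> {1 - \<delta> n..1 + \<delta> n}" if "cmod z = 1" for z
      unfolding \<delta>_def
      by (rule sector_pair_binomial_section) (use elim g that in \<open>auto simp: s_def \<delta>_def \<sigma>_def\<close>)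
    obtain w where w: "w \<in> bounded_weights 1 T"
      and X: "ereal (Re (poly ?X 1)) \<le> circle_sup_norm (monic_opuc w n)"
      using exists_bounded_weight[of "1 - \<delta> n" "1 + \<delta> n" T] XY elim by fastforce
    have "l n ^ n / (1 - l n) \<le> \<delta> n"
    proof -
      have "l n ^ n / (1 - l n) \<le> l n ^ n * 6 / (1 - l n)\<^sup>2"
        using elim by (intro frac_le) (auto simp: power2_eq_square intro!: mult_le_one)
      then show ?thesis by (simp add: \<delta>_def mult.commute)
    qed
    then have "real n powr h < Re (poly ?X 1)"
      using Re_binomial_section_ge[of "- g" "l n" n] elim g by (simp add: l_def)
    then have "ereal (real n powr h) < ereal (Re (poly ?X 1))" by simp
    also note X
    finally show ?case using w by blast
  qed
qed

text \<open>For the weight \<open>1\<close> the orthogonal polynomials are the monomials.\<close>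

lemma exists_weight_sup_norm_ge_1:
  assumes "1 \<le> T"
  shows "\<exists>w\<in>bounded_weights 1 T. 1 \<le> circle_sup_norm (monic_opuc w n)"
proof
  have w: "is_weight (\<lambda>_. 1)"
    by (rule is_weight_of_continuous_pos) auto
  then show "(\<lambda>_. 1) \<in> bounded_weights 1 T" using assms by (simp add: bounded_weights_def)
  have "monic_opuc (\<lambda>_. 1) n = monom 1 n"
  proof (rule monic_opuc_eqI[OF w])
    fix j assume j: "j < n"
    have "poly (monom 1 n) (cis \<theta>) * cnj (poly (monom 1 j) (cis \<theta>)) * complex_of_real 1 =
        cis \<theta> * cis \<theta> ^ (n - Suc j)" for \<theta>
    proof -
      have "cis \<theta> ^ n = cis \<theta> ^ j * (cis \<theta> * cis \<theta> ^ (n - Suc j))"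
        using j by (simp flip: power_add power_Suc)
      moreover have "cis \<theta> ^ j * cnj (cis \<theta> ^ j) = 1"
        by (simp add: complex_norm_square[symmetric] norm_power del: complex_cnj_power)
      ultimately show ?thesis by (simp add: poly_monom mult_ac)
    qed
    then show "weight_inner (\<lambda>_. 1) (monom 1 n) (monom 1 j) = 0"
      unfolding weight_inner_def
      using circle_integral_eq_0[of "\<lambda>z. z ^ (n - Suc j)"] by (simp add: continuous_intros holomorphic_intros)
  qed (simp_all add: degree_monom_eq)
  then show "1 \<le> circle_sup_norm (monic_opuc (\<lambda>_. 1) n)"
    using circle_sup_norm_ge[of 0 "monom 1 n"] by (simp add: poly_monom one_ereal_def)
qed

text \<open>The constant absorbs the finitely many \<open>n\<close> below the threshold, where the sup norm is at least
  \<open>1\<close>. The bound \<open>1\<close> is also all that a nonpositive exponent asks for.\<close>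

lemma lower_bound_all_n:
  assumes T: "1 \<le> T"
    and ev: "h \<le> 0 \<or> (\<forall>\<^sub>F n in sequentially. \<exists>w\<in>bounded_weights 1 T.
      ereal (real n powr h) < circle_sup_norm (monic_opuc w n))"
  shows "\<exists>C>0. \<forall>n\<ge>1. ereal (C * real n powr h) <
    (SUP w\<in>bounded_weights 1 T. circle_sup_norm (monic_opuc w n))"
proof -
  let ?S = "\<lambda>n. SUP w\<in>bounded_weights 1 T. circle_sup_norm (monic_opuc w n)"
  have S_1: "1 \<le> ?S n" for n
    using exists_weight_sup_norm_ge_1[OF T, of n] by (meson SUP_upper2)
  obtain N where N: "\<And>n. N \<le> n \<Longrightarrow> h \<le> 0 \<or> ereal (real n powr h) < ?S n"
    using ev unfolding eventually_sequentially by (metis (no_types, lifting) SUP_upper less_le_trans)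
  define C where "C = 1 / (2 * real (Suc N) powr \<bar>h\<bar>)"
  have M: "1 \<le> real (Suc N) powr \<bar>h\<bar>" by (rule ge_one_powr_ge_zero) auto
  have C: "0 < C" "C \<le> 1 / 2" using M by (auto simp: C_def divide_simps)
  have "ereal (C * real n powr h) < ?S n" if n: "1 \<le> n" for n
  proof (cases "h \<le> 0 \<or> n < N")
    case True
    have "real n powr h \<le> real (Suc N) powr \<bar>h\<bar>"
    proof (cases "h \<le> 0")
      case True
      then have "real n powr h \<le> 1 powr h" using n by (intro powr_mono2') auto
      then show ?thesis using M by simp
    next
      case False
      with \<open>h \<le> 0 \<or> n < N\<close> show ?thesis by (simp add: powr_mono2)
    qed
    then have "C * real n powr h \<le> C * real (Suc N) powr \<bar>h\<bar>"
      using C by (intro mult_left_mono) auto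
    also have "\<dots> = 1 / 2" using M by (simp add: C_def)
    finally have "ereal (C * real n powr h) < 1" by (simp add: one_ereal_def)
    then show ?thesis using S_1 by (rule less_le_trans)
  next
    case False
    have "C * real n powr h \<le> 1 * real n powr h" using C by (intro mult_right_mono) auto
    then have "ereal (C * real n powr h) \<le> ereal (real n powr h)" by simp
    also have "\<dots> < ?S n" using N[of n] False by auto
    finally show ?thesis .
  qed
  then show ?thesis using C by blast
qed

section \<open>The dependence of the exponent on the bound of the weight\<close>

text \<open>With \<open>g = \<epsilon> / 32\<close> one has \<open>sin (\<pi> * g) \<le> \<epsilon> / 8\<close>, and the oscillation is at most
  \<open>(1 + 2 / 7 * \<epsilon>)\<^sup>2 < 1 + \<epsilon>\<close>; any exponent below \<open>g\<close>, such as \<open>g / 2\<close>, is then reached.\<close>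

lemma lower_bound_near_1:
  assumes e: "0 < \<epsilon>" "\<epsilon> \<le> 1"
  shows "\<exists>C>0. \<forall>n\<ge>1. ereal (C * real n powr (1 / 64 * \<epsilon>)) <
    (SUP w\<in>bounded_weights 1 (1 + \<epsilon>). circle_sup_norm (monic_opuc w n))"
proof (intro lower_bound_all_n disjI2 eventually_large_opuc)
  let ?x = "sin (pi * (\<epsilon> / 32))"
  have x: "0 \<le> ?x" "?x \<le> \<epsilon> / 8"
  proof -
    have "pi * (\<epsilon> / 32) \<le> 4 * (\<epsilon> / 32)"
      using pi_less_4 e by (intro mult_right_mono) auto
    moreover have "?x \<le> pi * (\<epsilon> / 32)" using e by (intro sin_x_le_x) auto
    ultimately show "?x \<le> \<epsilon> / 8" by linarith
    have "pi * (\<epsilon> / 32) \<le> pi * 1" using e by (intro mult_left_mono) auto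
    then show "0 \<le> ?x" using e by (intro sin_ge_zero) auto
  qed
  have "(1 + ?x) / (1 - ?x) \<le> (1 + \<epsilon> / 8) / (1 - \<epsilon> / 8)"
    using x e by (intro frac_le) auto
  also have "\<dots> \<le> 1 + 2 / 7 * \<epsilon>"
    using e by (simp add: field_simps power2_eq_square[symmetric])
  finally have "((1 + ?x) / (1 - ?x))\<^sup>2 \<le> (1 + 2 / 7 * \<epsilon>)\<^sup>2"
    using x e by (intro power_mono) auto
  also have "\<dots> = 1 + 4 / 7 * \<epsilon> + 4 / 49 * (\<epsilon> * \<epsilon>)" by (simp add: power2_eq_square field_simps)
  also have "\<dots> < 1 + \<epsilon>"
  proof -
    have "\<epsilon> * \<epsilon> \<le> \<epsilon> * 1" using e by (intro mult_left_mono) auto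
    then show ?thesis using e by linarith
  qed
  finally show "((1 + ?x) / (1 - ?x))\<^sup>2 < 1 + \<epsilon>" .
qed (use e in auto)

text \<open>By the mean value theorem, as the cosine exceeds \<open>1 / 2\<close> on \<open>{0<..<\<pi> / 3}\<close>.\<close>

lemma less_sin_pi_times:
  fixes t :: real
  assumes t: "0 < t" "t \<le> 1 / 4"
  shows "t < sin (pi * t)"
proof -
  have "0 < pi * t" using t by simp
  then obtain y where y: "0 < y" "y < pi * t" and "sin (pi * t) - sin 0 = (pi * t - 0) * cos y"
    using MVT2[of 0 "pi * t" sin cos] DERIV_sin by blast
  then have sin: "sin (pi * t) = pi * t * cos y" by simp
  have "pi * t \<le> pi / 3" using t by simp
  then have "cos (pi / 3) < cos y"
    using y by (intro cos_monotone_0_pi) linarith+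
  then have "1 / 2 < cos y" by (simp add: cos_60)
  then have "pi * t * (1 / 2) < sin (pi * t)"
    unfolding sin using \<open>0 < pi * t\<close> by (rule mult_strict_left_mono)
  moreover have "2 * t \<le> pi * t" using t pi_ge_two by (intro mult_right_mono) auto
  ultimately show ?thesis by simp
qed

text \<open>Put \<open>t = T powr (- 1 / 4)\<close> and \<open>g = 1 / 2 - 2 * t\<close>. Then \<open>1 - sin (\<pi> * g) = 2 * (sin (\<pi> * t))\<^sup>2 > 2 * t\<^sup>2\<close>,
  so the oscillation is less than \<open>(1 / t\<^sup>2)\<^sup>2 = T\<close>. The exponent \<open>1 / 2 - 4 * t\<close> lies below \<open>g\<close>,
  and it is positive only if \<open>t < 1 / 8\<close>, which is the range where the estimates apply.\<close>

lemma lower_bound_large: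
  assumes T: "2 < T"
  shows "\<exists>C>0. \<forall>n\<ge>1. ereal (C * real n powr (1 / 2 - 4 * T powr (- 1 / 4))) <
    (SUP w\<in>bounded_weights 1 T. circle_sup_norm (monic_opuc w n))"
proof (rule lower_bound_all_n)
  define t where "t = T powr (- 1 / 4)"
  have t: "0 < t" using T by (simp add: t_def)
  have "t ^ 4 = T powr (-1)"
    using T by (simp add: t_def powr_powr flip: powr_realpow)
  then have tT: "1 / t ^ 4 = T" using T by (simp add: powr_minus_divide)
  show "1 / 2 - 4 * T powr (- 1 / 4) \<le> 0 \<or> (\<forall>\<^sub>F n in sequentially. \<exists>w\<in>bounded_weights 1 T.
      ereal (real n powr (1 / 2 - 4 * T powr (- 1 / 4))) < circle_sup_norm (monic_opuc w n))"
    unfolding t_def[symmetric]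
  proof (cases "t < 1 / 8")
    case True
    have "\<forall>\<^sub>F n in sequentially. \<exists>w\<in>bounded_weights 1 T.
      ereal (real n powr (1 / 2 - 4 * t)) < circle_sup_norm (monic_opuc w n)"
    proof (rule eventually_large_opuc)
      let ?x = "sin (pi * (1 / 2 - 2 * t))"
      have "?x = cos (2 * (pi * t))"
        by (simp add: cos_sin_eq algebra_simps)
      then have x: "?x = 1 - 2 * (sin (pi * t))\<^sup>2" by (simp add: cos_double_sin)
      have "t\<^sup>2 < (sin (pi * t))\<^sup>2"
        using less_sin_pi_times[of t] t True by (intro power_strict_mono) auto
      then have gap: "2 * t\<^sup>2 < 1 - ?x" unfolding x by simp
      have "0 \<le> ?x"
        using t True by (intro sin_ge_zero) (auto simp: algebra_simps)
      have "(1 + ?x) / (1 - ?x) < 2 / (2 * t\<^sup>2)"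
        using gap t \<open>0 \<le> ?x\<close> by (intro frac_less2) auto
      then have "((1 + ?x) / (1 - ?x))\<^sup>2 < (1 / t\<^sup>2)\<^sup>2"
        using gap t \<open>0 \<le> ?x\<close> by (intro power_strict_mono) auto
      also have "\<dots> = T" using tT by (simp add: power_divide flip: power_mult)
      finally show "((1 + ?x) / (1 - ?x))\<^sup>2 < T" .
    qed (use t True in auto)
    then show "1 / 2 - 4 * t \<le> 0 \<or> (\<forall>\<^sub>F n in sequentially. \<exists>w\<in>bounded_weights 1 T.
      ereal (real n powr (1 / 2 - 4 * t)) < circle_sup_norm (monic_opuc w n))" ..
  qed auto
qed (use T in auto)

theorem theorem3p1:
  shows "\<exists>(C5::real) (C6::real) (C1 :: real \<Rightarrow> real) (C2 :: real \<Rightarrow> real).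
    0 < C5 \<and> 0 < C6 \<and> (\<forall>\<epsilon>\<in>{0<..1}. 0 < C1 \<epsilon>) \<and> (\<forall>T\<in>{2<..}. 0 < C2 T) \<and>
    (\<forall>n::nat. 1 \<le> n \<longrightarrow>
      (\<forall>\<epsilon>\<in>{0<..1}.
         (SUP w\<in>bounded_weights 1 (1 + \<epsilon>). circle_sup_norm (monic_opuc w n))
           > ereal (C1 \<epsilon> * real n powr (C5 * \<epsilon>))) \<and>
      (\<forall>T\<in>{2<..}.
         (SUP w\<in>bounded_weights 1 T. circle_sup_norm (monic_opuc w n))
           > ereal (C2 T * real n powr (1 / 2 - C6 * T powr (- 1 / 4)))))"
proof -
  have "\<forall>\<epsilon>\<in>{0<..1::real}. \<exists>C>0. \<forall>n\<ge>1. ereal (C * real n powr (1 / 64 * \<epsilon>)) <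
      (SUP w\<in>bounded_weights 1 (1 + \<epsilon>). circle_sup_norm (monic_opuc w n))"
    by (intro ballI lower_bound_near_1) (simp_all only: greaterThanAtMost_iff)
  then obtain C1 where C1: "\<forall>\<epsilon>\<in>{0<..1::real}. 0 < C1 \<epsilon> \<and>
      (\<forall>n\<ge>1. ereal (C1 \<epsilon> * real n powr (1 / 64 * \<epsilon>)) <
        (SUP w\<in>bounded_weights 1 (1 + \<epsilon>). circle_sup_norm (monic_opuc w n)))"
    by (rule bchoice[THEN exE])
  have "\<forall>T\<in>{2::real<..}. \<exists>C>0. \<forall>n\<ge>1. ereal (C * real n powr (1 / 2 - 4 * T powr (- 1 / 4))) <
      (SUP w\<in>bounded_weights 1 T. circle_sup_norm (monic_opuc w n))"
    by (intro ballI lower_bound_large) (simp only: greaterThan_iff)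
  then obtain C2 where C2: "\<forall>T\<in>{2::real<..}. 0 < C2 T \<and>
      (\<forall>n\<ge>1. ereal (C2 T * real n powr (1 / 2 - 4 * T powr (- 1 / 4))) <
        (SUP w\<in>bounded_weights 1 T. circle_sup_norm (monic_opuc w n)))"
    by (rule bchoice[THEN exE])
  show ?thesis
    by (rule exI[of _ "1 / 64"], rule exI[of _ 4], rule exI[of _ C1], rule exI[of _ C2], intro conjI)
      (use C1 C2 in \<open>simp | blast\<close>)+
qed

end
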